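(* Let $c=\sqrt2-1$. Let $q_1,q_2,\dots$ be any infinite sequence of primes with $2^{2j-1}<q_j\le 2^{2j+1}$ for all $j\ge1$, and for each $j$ let $g_j$ be any primitive root modulo $q_j$. Let $(a_p)_{p\in\mathcal P}$, $\mathcal P_k$ and $\mathcal P^*$ be as defined in the context. Then $A=(a_p)_{p\in\mathcal P^*}$ is an infinite Sidon sequence (all sums $a+a'$ with $a\le a'$ in $A$ are distinct) and its counting function satisfies $A(x)=x^{\sqrt2-1+o(1)}$ as $x\to\infty$.
   Context: Fix $c$ with $0<c<1/2$ (here $c=\sqrt2-1$). Let $\mathcal P$ be the set of all primes and $\mathcal P=\bigcup_{k\ge2}\mathcal P_k$ with $\mathcal P_k=\{p \text{ prime}: 2^{c(k-1)^2-3}<p\le 2^{ck^2-3}\}$. For $p\in\mathcal P_k$ and $1\le j\le k$, let $x_j(p)$ be the integer with $q_j+1\le x_j(p)\le 2q_j-1$ and $g_j^{x_j(p)}\equiv p\pmod{q_j}$; set $x_j(p)=0$ for $j>k$; define $a_p=\sum_{j=1}^{k}x_j(p)\prod_{i<j}(4q_i)$ (i.e. $a_p$ has digits $x_k(p)\dots x_1(p)$ in the mixed-radix base $4q_1,4q_2,\dots$). For integers $2\le k_2<k_1$ write $Q_1=q_1\cdots q_{k_2}$, $Q_2=q_{k_2+1}\cdots q_{k_1}$ and $$S_{k_2,k_1}=\Big\{s_1Q_1+s_2p_2'Q_2:\ 1\le|s_1|\le \tfrac{2^{c(k_1^2+k_2^2)-6}}{Q_1},\ 1\le|s_2|\le\tfrac{2^{ck_1^2-3}}{Q_2},\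 p_2'\in\mathcal P_{k_2}\Big\}$$ ($s_1,s_2$ integers). Let $\mathcal B_{k_1}=\{p_1\in\mathcal P_{k_1}: p_1\mid s \text{ for some nonzero } s\in S_{k_2,k_1} \text{ for some } k_2 \text{ with } k_2^2<\tfrac{c}{1-c}k_1^2\}$, and $\mathcal P^*=\bigcup_{k_1\ge2}(\mathcal P_{k_1}\setminus\mathcal B_{k_1})$. The counting function is $A(x)=\#\{p\in\mathcal P^*: a_p\le x\}$.
   Formalization: The sequence A is indexed only by those p in P* for which all x_j(p), j ≤ k, exist; this drops the finitely many p equal to some q_j with j ≤ k (always including q_1), for which g_j^x ≡ p (mod q_j) has no solution and a_p is undefined. *)

theory Defs
  imports Complex_Main "HOL-Number_Theory.Number_Theory" "HOL-Library.Landau_Symbols"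
begin

text \<open>
  The sequences \<open>q\<close> and \<open>g\<close> are indexed by \<open>j \<ge> 1\<close>; the values \<open>q 0\<close> and \<open>g 0\<close> are never used.
\<close>

definition prime_block :: "real \<Rightarrow> nat \<Rightarrow> nat set" where
  "prime_block c k = {p. prime p \<and>
     2 powr (c * (real k - 1)\<^sup>2 - 3) < real p \<and> real p \<le> 2 powr (c * (real k)\<^sup>2 - 3)}"

text \<open>For \<open>0 < c < 4\<close> the blocks with \<open>k \<ge> 2\<close> partition the primes (\<open>ex1_level\<close> below).\<close>

definition level :: "real \<Rightarrow> nat \<Rightarrow> nat" where
  "level c p = (THE k. 2 \<le> k \<and> p \<in> prime_block c k)"

definition is_digit :: "(nat \<Rightarrow> nat) \<Rightarrow> (nat \<Rightarrow> nat) \<Rightarrow> nat \<Rightarrow> nat \<Rightarrow> nat \<Rightarrow> bool" where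
  "is_digit q g j p x \<longleftrightarrow> q j + 1 \<le> x \<and> x \<le> 2 * q j - 1 \<and> [g j ^ x = p] (mod q j)"

definition digit :: "real \<Rightarrow> (nat \<Rightarrow> nat) \<Rightarrow> (nat \<Rightarrow> nat) \<Rightarrow> nat \<Rightarrow> nat \<Rightarrow> nat" where
  "digit c q g j p = (if j \<in> {1..level c p} then (THE x. is_digit q g j p x) else 0)"

definition sidon_term :: "real \<Rightarrow> (nat \<Rightarrow> nat) \<Rightarrow> (nat \<Rightarrow> nat) \<Rightarrow> nat \<Rightarrow> nat" where
  "sidon_term c q g p = (\<Sum>j\<in>{1..level c p}. digit c q g j p * (\<Prod>i\<in>{1..<j}. 4 * q i))"

text \<open>
  The congruence \<open>g\<^sub>j\<^sup>x \<equiv> p\<close> modulo \<open>q\<^sub>j\<close> has no solution \<open>x\<close> when \<open>p = q\<^sub>j\<close>, so the term of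
  index \<open>p\<close> is meaningful only if \<open>p\<close> is none of \<open>q\<^sub>1, \<dots>, q\<^sub>k\<close>, where \<open>k\<close> is the level of \<open>p\<close>.
  This fails for some primes: \<open>q\<^sub>1\<close> is 3, 5 or 7, and these have level 4 for \<open>c = \<surd>2 - 1\<close>.
  The following predicate says that all digits of \<open>p\<close> exist; only finitely many primes
  violate it (\<open>finite_not_term_defined\<close> below).
\<close>

definition term_defined :: "real \<Rightarrow> (nat \<Rightarrow> nat) \<Rightarrow> (nat \<Rightarrow> nat) \<Rightarrow> nat \<Rightarrow> bool" where
  "term_defined c q g p \<longleftrightarrow> (\<forall>j\<in>{1..level c p}. \<exists>x. is_digit q g j p x)"

definition sieve_set :: "real \<Rightarrow> (nat \<Rightarrow> nat) \<Rightarrow> nat \<Rightarrow> nat \<Rightarrow> int set" where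
  "sieve_set c q k2 k1 =
     (let Q1 = (\<Prod>i\<in>{1..k2}. q i); Q2 = (\<Prod>i\<in>{k2+1..k1}. q i) in
      {s1 * int Q1 + s2 * int p2 * int Q2 | s1 s2 p2.
         1 \<le> \<bar>s1\<bar> \<and> real_of_int \<bar>s1\<bar> \<le> 2 powr (c * ((real k1)\<^sup>2 + (real k2)\<^sup>2) - 6) / real Q1 \<and>
         1 \<le> \<bar>s2\<bar> \<and> real_of_int \<bar>s2\<bar> \<le> 2 powr (c * (real k1)\<^sup>2 - 3) / real Q2 \<and>
         p2 \<in> prime_block c k2})"

definition bad_primes :: "real \<Rightarrow> (nat \<Rightarrow> nat) \<Rightarrow> nat \<Rightarrow> nat set" where
  "bad_primes c q k1 =
     {p1 \<in> prime_block c k1. \<exists>k2 s. 2 \<le> k2 \<and> k2 < k1 \<and> (real k2)\<^sup>2 < c / (1 - c) * (real k1)\<^sup>2 \<and>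
        s \<in> sieve_set c q k2 k1 \<and> s \<noteq> 0 \<and> int p1 dvd s}"

definition good_primes :: "real \<Rightarrow> (nat \<Rightarrow> nat) \<Rightarrow> nat set" where
  "good_primes c q = (\<Union>k1\<in>{2..}. prime_block c k1 - bad_primes c q k1)"

definition sidon_set :: "nat set \<Rightarrow> bool" where
  "sidon_set A \<longleftrightarrow> (\<forall>a\<in>A. \<forall>a'\<in>A. \<forall>b\<in>A. \<forall>b'\<in>A.
     a \<le> a' \<longrightarrow> b \<le> b' \<longrightarrow> a + a' = b + b' \<longrightarrow> a = b \<and> a' = b')"

lemma prime_block_unique:
  assumes c: "c > 0" and k: "1 \<le> k" "1 \<le> l" and p: "p \<in> prime_block c k" "p \<in> prime_block c l"
  shows "k = l"
proof -
  have "False" if "1 \<le> a" "a < b" "p \<in> prime_block c a" "p \<in> prime_block c b" for a b :: nat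
  proof -
    have "real a \<le> real b - 1" using that by linarith
    hence "(real a)\<^sup>2 \<le> (real b - 1)\<^sup>2" by (intro power_mono) auto
    hence "c * (real a)\<^sup>2 - 3 \<le> c * (real b - 1)\<^sup>2 - 3" using c by simp
    hence "2 powr (c * (real a)\<^sup>2 - 3) \<le> (2 powr (c * (real b - 1)\<^sup>2 - 3) :: real)" by simp
    moreover have "real p \<le> 2 powr (c * (real a)\<^sup>2 - 3)" "2 powr (c * (real b - 1)\<^sup>2 - 3) < real p"
      using that(3,4) by (simp_all add: prime_block_def)
    ultimately show False by linarith
  qed
  thus ?thesis using k p by (metis linorder_neqE_nat)
qed

lemma ex1_level:
  assumes c: "0 < c" "c < 4" and p: "prime p"
  shows "\<exists>!k. 2 \<le> k \<and> p \<in> prime_block c k"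
proof -
  define P where "P k \<longleftrightarrow> real p \<le> 2 powr (c * (real k)\<^sup>2 - 3)" for k :: nat
  have "\<exists>k. P k"
  proof -
    obtain n :: nat where n: "real n > (log 2 (real p) + 3) / c" using reals_Archimedean2 by blast
    have "log 2 (real p) + 3 < c * real n" using n c by (simp add: field_simps)
    also have "c * real n \<le> c * (real n)\<^sup>2"
      using c by (cases n) (auto simp: power2_eq_square)
    finally have "log 2 (real p) \<le> c * (real n)\<^sup>2 - 3" by simp
    hence "real p \<le> 2 powr (c * (real n)\<^sup>2 - 3)"
      using p prime_gt_0_nat[of p] by (simp add: log_le_iff)
    thus ?thesis unfolding P_def by blast
  qed
  define k where "k = (LEAST k. P k)"
  have Pk: "P k" unfolding k_def using \<open>\<exists>k. P k\<close> by (rule LeastI_ex)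
  have p2: "real p \<ge> 2" using p prime_ge_2_nat by fastforce
  have small: "\<not> P m" if "m \<le> 1" for m
  proof
    assume "P m"
    hence "2 \<le> (2::real) powr (c * (real m)\<^sup>2 - 3)" using p2 unfolding P_def by simp
    moreover have "c * (real m)\<^sup>2 - 3 < 1" using that c by (cases m) auto
    hence "(2::real) powr (c * (real m)\<^sup>2 - 3) < 2 powr 1" by (intro powr_less_mono) auto
    ultimately show False by simp
  qed
  have k2: "2 \<le> k" using small[of k] Pk by linarith
  have "\<not> P (k - 1)" unfolding k_def by (rule not_less_Least) (use k2 k_def in auto)
  hence "p \<in> prime_block c k"
    using Pk k2 p unfolding P_def prime_block_def by (auto simp: of_nat_diff)
  thus ?thesis using k2 prime_block_unique[OF c(1)] by (meson le_trans one_le_numeral)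
qed

lemma level_eq:
  assumes "0 < c" "2 \<le> k" "p \<in> prime_block c k"
  shows "level c p = k"
  unfolding level_def
  by (rule the_equality) (use assms prime_block_unique[OF assms(1)] in \<open>auto intro: le_trans\<close>)

lemma ex1_digit_iff:
  assumes q: "prime (q j)" "2 < q j" and g: "residue_primroot (q j) (g j)" and p: "prime p"
  shows "(\<exists>!x. is_digit q g j p x) \<longleftrightarrow> p \<noteq> q j"
    and "(\<exists>x. is_digit q g j p x) \<longleftrightarrow> p \<noteq> q j"
proof -
  let ?q = "q j" and ?g = "g j"
  have cop: "coprime ?q ?g" and ord: "ord ?q ?g = ?q - 1"
    using g q by (auto simp: residue_primroot_def totient_prime)
  have uniq: "x = y" if "is_digit q g j p x" "is_digit q g j p y" for x y
  proof -
    have "[?g ^ x = ?g ^ y] (mod ?q)"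
      using that unfolding is_digit_def by (meson cong_sym cong_trans)
    hence "[x = y] (mod (?q - 1))"
      using order_divides_expdiff[OF cop] ord by simp
    moreover have "?q + 1 \<le> x" "x \<le> 2 * ?q - 1" "?q + 1 \<le> y" "y \<le> 2 * ?q - 1"
      using that by (auto simp: is_digit_def)
    ultimately have *: "[int x = int y] (mod (int ?q - 1))" and "\<bar>int x - int y\<bar> < int ?q - 1"
      using q(2) by (auto simp: cong_int_iff[symmetric] of_nat_diff)
    hence "int x - int y = 0"
      by (metis cong_iff_dvd_diff dvd_imp_le_int linorder_not_le abs_of_pos abs_ge_zero order_le_less_trans)
    thus ?thesis by simp
  qed
  have ex: "\<exists>x. is_digit q g j p x" if ne: "p \<noteq> ?q"
  proof -
    have "coprime ?q p" using p q(1) ne by (simp add: primes_coprime)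
    hence "p mod ?q \<in> totatives ?q"
      using q by (auto simp: totatives_def coprime_commute coprime_mod_left_iff
        mod_greater_zero_iff_not_dvd intro!: Nat.gr0I dest: coprime_common_divisor_nat)
    moreover have "(\<lambda>i. ?g ^ i mod ?q) ` {..<totient ?q} = totatives ?q"
      using residue_primroot_is_generator[of ?q ?g] g q(2) by (simp add: bij_betw_def)
    ultimately obtain i where i: "i < totient ?q" "?g ^ i mod ?q = p mod ?q"
      by (metis (no_types, lifting) imageE lessThan_iff)
    have i': "i < ?q - 1" using i q by (simp add: totient_prime)
    have one: "[?g ^ (?q - 1) = 1] (mod ?q)" using ord_works[of ?g ?q] ord by (metis ord)
    define x where "x = (if i < 2 then i + 2 * (?q - 1) else i + (?q - 1))"
    have "[?g ^ x = ?g ^ i] (mod ?q)"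
    proof -
      have "[?g ^ (i + k * (?q - 1)) = ?g ^ i] (mod ?q)" for k
      proof -
        have "[?g ^ i * (?g ^ (?q - 1)) ^ k = ?g ^ i * 1 ^ k] (mod ?q)"
          by (intro cong_mult cong_pow one cong_refl)
        moreover have "?g ^ (i + k * (?q - 1)) = ?g ^ i * (?g ^ (?q - 1)) ^ k"
          by (metis power_add power_mult mult.commute)
        ultimately show ?thesis by simp
      qed
      from this[of 1] this[of 2] show ?thesis by (simp add: x_def)
    qed
    moreover have "?q + 1 \<le> x" "x \<le> 2 * ?q - 1" using i' q(2) by (auto simp: x_def)
    ultimately show ?thesis using i(2) unfolding is_digit_def by (auto simp: cong_def)
  qed
  have nex: "p \<noteq> ?q" if "is_digit q g j p x" for x
  proof
    assume "p = ?q"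
    hence "[?g ^ x = 0] (mod ?q)" using that by (simp add: is_digit_def cong_def)
    hence "?q dvd ?g ^ x" by (simp add: cong_0_iff)
    hence "?q dvd ?g" using q(1) prime_dvd_power by blast
    thus False using cop q(1) by (metis coprime_absorb_left not_prime_unit)
  qed
  show "(\<exists>!x. is_digit q g j p x) \<longleftrightarrow> p \<noteq> q j" using uniq ex nex by metis
  show "(\<exists>x. is_digit q g j p x) \<longleftrightarrow> p \<noteq> q j" using ex nex by metis
qed

lemma finite_not_term_defined:
  assumes q: "\<And>j. j \<ge> 1 \<Longrightarrow> prime (q j)"
    and qb: "\<And>j. j \<ge> 1 \<Longrightarrow> 2 ^ (2 * j - 1) < q j \<and> q j \<le> 2 ^ (2 * j + 1)"
    and g: "\<And>j. j \<ge> 1 \<Longrightarrow> residue_primroot (q j) (g j)"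
  shows "finite {p. prime p \<and> \<not> term_defined (sqrt 2 - 1) q g p}"
proof (rule finite_subset)
  let ?c = "sqrt 2 - 1 :: real"
  show "{p. prime p \<and> \<not> term_defined ?c q g p} \<subseteq> {.. 2 ^ 21}"
  proof clarify
    fix p assume p: "prime p" and "\<not> term_defined ?c q g p"
    then obtain j where j: "1 \<le> j" "j \<le> level ?c p" "\<not> (\<exists>x. is_digit q g j p x)"
      by (auto simp: term_defined_def)
    have "(2::nat) ^ 1 \<le> 2 ^ (2 * j - 1)" using j(1) by (intro power_increasing) auto
    hence "2 < q j" using qb[OF j(1)] by simp
    hence pq: "p = q j" using ex1_digit_iff(2)[of q j g p] q g j p by blast
    define k where "k = level ?c p"
    have c: "?c > 2/5" "?c < 4"
      by (use real_less_rsqrt[of "7/5" 2] sqrt2_less_2 in \<open>simp_all add: power2_eq_square\<close>)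
    have k: "2 \<le> k" "p \<in> prime_block ?c k"
      using theI'[OF ex1_level[of ?c p]] c p unfolding k_def level_def by auto
    have "2 powr (?c * (real k - 1)\<^sup>2 - 3) < real p" using k(2) by (simp add: prime_block_def)
    also have "real p \<le> 2 ^ (2 * j + 1)" unfolding pq using qb[OF j(1)] by (metis of_nat_le_iff of_nat_numeral of_nat_power)
    also have "\<dots> = 2 powr (2 * real j + 1)" using powr_realpow[of 2 "2 * j + 1"] by (simp add: algebra_simps)
    finally have "?c * (real k - 1)\<^sup>2 - 3 < 2 * real j + 1" by simp
    also have "real j \<le> real k" using j(2) by (simp add: k_def)
    finally have 1: "?c * (real k - 1)\<^sup>2 - 3 < 2 * real k + 1" by simp
    have 2: "2/5 * (real k - 1)\<^sup>2 \<le> ?c * (real k - 1)\<^sup>2"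
      using c by (intro mult_right_mono) auto
    have "k \<le> 10"
    proof (rule ccontr)
      assume "\<not> k \<le> 10"
      hence u: "real k - 1 \<ge> 10" by simp
      hence "10 * (real k - 1) \<le> (real k - 1)\<^sup>2" unfolding power2_eq_square by (intro mult_right_mono) auto
      moreover have "2 * (real k - 1)\<^sup>2 \<le> 5 * (?c * (real k - 1)\<^sup>2)" using 2 by simp
      moreover have False if "10 * v \<le> w" "e < 2 * v + 6" "2 * w \<le> 5 * e" "10 \<le> v" for v w e :: real
        using that by linarith
      moreover have "?c * (real k - 1)\<^sup>2 < 2 * (real k - 1) + 6" using 1 by simp
      ultimately show False using u by blast
    qed
    hence "j \<le> 10" using j(2) k_def by simp
    hence "(2::nat) ^ (2 * j + 1) \<le> 2 ^ 21" by (intro power_increasing) auto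
    thus "p \<le> 2 ^ 21" using qb[OF j(1)] pq by linarith
  qed
qed simp

end

theory Submission
  imports Defs "HOL-Real_Asymp.Real_Asymp"
begin

text \<open>
  Adding two terms produces no carry in the base \<open>4q\<^sub>1, 4q\<^sub>2, \<dots>\<close>, so a sum \<open>a\<^bsub>p\<^sub>1\<^esub> + a\<^bsub>p\<^sub>2\<^esub>\<close>
  determines the levels \<open>k\<^sub>2 \<le> k\<^sub>1\<close>, the product \<open>p\<^sub>1p\<^sub>2\<close> modulo \<open>Q\<^sub>1\<close> and \<open>p\<^sub>1\<close> modulo
  \<open>Q\<^sub>2\<close>. If \<open>k\<^sub>2\<close> is large, then \<open>Q\<^sub>1\<close> exceeds the products and these are equal; otherwise two
  different representations give \<open>p\<^sub>1(p\<^sub>2 - p\<^sub>2') = s\<^sub>1Q\<^sub>1 + s\<^sub>2p\<^sub>2'Q\<^sub>2 \<noteq> 0\<close>, so \<open>p\<^sub>1\<close> is bad.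

  As \<open>2^(k\<^sup>2) \<le> a\<^sub>p < 2^(k\<^sup>2 + 4k)\<close> at level \<open>k\<close>, the upper bound for the counting function is immediate.
  For the lower bound, the sieve at \<open>k\<^sub>1\<close> removes up to a factor polynomial in \<open>k\<^sub>1\<close> at most
  \<open>2^((2c-1)k\<^sub>1\<^sup>2 + 2ck\<^sub>2\<^sup>2)\<close> primes, and this exponent equals \<open>ck\<^sub>1\<^sup>2\<close> exactly when
  \<open>k\<^sub>2 = \<alpha>k\<^sub>1\<close>, where \<open>\<alpha>\<^sup>2 = c/(1-c)\<close>. One of any two consecutive \<open>k\<^sub>1\<close> has no integer just below
  \<open>\<alpha>k\<^sub>1\<close>; for it a factor exponential in \<open>k\<^sub>1\<close> is gained, which beats the polynomial factors and the
  logarithm lost in Chebyshev's lower bound for the number of primes. Using only such \<open>k\<^sub>1\<close> suffices, because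
  consecutive levels change \<open>log a\<^sub>p\<close> by a factor tending to 1.
\<close>

subsection \<open>A lower bound for the number of primes\<close>

text \<open>The induction step follows Leibniz' harmonic triangle: the reciprocal of
  \<open>Suc k * (n choose Suc k)\<close> is a difference of reciprocals of two numbers that divide
  the lcm by the induction hypothesis. Used at the central coefficient, this replaces the usual
  study of its prime factors in Chebyshev's bound.\<close>

lemma mult_binomial_dvd_Lcm:
  assumes "1 \<le> k" "k \<le> n"
  shows "k * (n choose k) dvd Lcm {1..n}"
  using assms
proof (induction k arbitrary: n rule: nat_induct_at_least)
  case base
  thus ?case by (auto intro: dvd_Lcm)
next
  case (Suc k)
  define D where "D = Lcm {1..n}"
  have "Lcm {1..n - 1} dvd D"
    unfolding D_def by (intro Lcm_subset) auto
  hence "k * ((n - 1) choose k) dvd D"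
    using Suc.IH[of "n - 1"] Suc.prems by (auto intro: dvd_trans)
  then obtain b where b: "D = b * (k * ((n - 1) choose k))"
    by (metis dvd_div_mult_self)
  obtain a where a: "D = a * (k * (n choose k))"
    using Suc.IH[of n] Suc.prems unfolding D_def by (metis dvdE mult.commute Suc_leD)
  have W1: "Suc k * (n choose Suc k) = n * ((n - 1) choose k)"
    by (rule binomial_absorption)
  have "(n - k) * (n choose k) = n * ((n - 1) choose k)"
    by (metis binomial_absorb_comp)
  hence W2: "Suc k * (n choose Suc k) = (n - k) * (n choose k)" using W1 by simp
  \<comment> \<open>Leibniz triangle: \<open>1/W = 1/(k * (n-1 choose k)) - 1/(k * (n choose k))\<close>, multiplied by \<open>D\<close>\<close>
  let ?W = "int (Suc k * (n choose Suc k))"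
  have "int k * ((int b - int a) * ?W) = int k * int D"
  proof -
    have "int k * (int b * ?W) = int n * int D" unfolding W1 b by simp
    moreover have "int k * (int a * ?W) = int (n - k) * int D" unfolding W2 a by simp
    ultimately show ?thesis using Suc.prems by (simp add: algebra_simps of_nat_diff)
  qed
  hence "(int b - int a) * ?W = int D" using Suc.hyps by simp
  hence "?W dvd int D" by (metis dvd_triv_right)
  thus ?case unfolding D_def by (simp only: of_nat_dvd_iff)
qed

text \<open>The full power of a prime \<open>p\<close> in the lcm already divides one of the numbers
  up to \<open>n\<close>, so it is at most \<open>n\<close>; only primes up to \<open>n\<close>
  contribute such a factor.\<close>

lemma Lcm_le_power_primes:
  fixes n :: nat
  assumes "n > 0"
  shows "Lcm {1..n} \<le> n ^ card {p. prime p \<and> p \<le> n}"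
proof -
  define S where "S = {p. prime p \<and> p \<le> n}"
  have fin: "finite S" unfolding S_def by (rule finite_subset[of _ "{..n}"]) auto
  define L where "L = Lcm {1..n}"
  have L0: "L \<noteq> 0" by (auto simp: L_def Lcm_0_iff)
  have le: "p ^ multiplicity p L \<le> n" if p: "prime p" for p
  proof -
    have "\<exists>m\<in>{1..n}. multiplicity p L \<le> multiplicity p m"
    proof (rule ccontr)
      assume *: "\<not> ?thesis"
      \<comment> \<open>Were every exponent of \<open>p\<close> in \<open>1..n\<close> smaller than
        the one in \<open>L\<close>, then \<open>p ^ M * r\<close> would be a common multiple with
        too few factors \<open>p\<close>.\<close>
      define M where "M = Max (multiplicity p ` {1..n})"
      have lt: "M < multiplicity p L"
        unfolding M_def using * assms by (subst Max_less_iff) (auto simp: not_le)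
      obtain r where r: "L = p ^ multiplicity p L * r" "\<not> p dvd r"
        using multiplicity_decompose'[of L p] L0 p by (metis not_prime_unit)
      have "L dvd p ^ M * r"
        unfolding L_def
      proof (rule Lcm_least)
        fix m assume m: "m \<in> {1..n}"
        hence mL: "m dvd L" by (auto simp: L_def)
        obtain t where t: "m = p ^ multiplicity p m * t" "\<not> p dvd t"
          using multiplicity_decompose'[of m p] m p by (metis not_prime_unit atLeastAtMost_iff not_one_le_zero)
        have "t dvd L" using mL t(1) by (metis dvd_mult_right)
        moreover have "coprime t (p ^ multiplicity p L)"
          using t(2) p by (metis coprime_commute coprime_power_left_iff prime_imp_coprime)
        ultimately have "t dvd r" using r(1) by (metis coprime_dvd_mult_right_iff)
        moreover have "multiplicity p m \<le> M" unfolding M_def using m by (intro Max_ge) auto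
        hence "p ^ multiplicity p m dvd p ^ M" by (rule le_imp_power_dvd)
        ultimately show "m dvd p ^ M * r" by (subst t(1)) (rule mult_dvd_mono)
      qed
      hence "p ^ multiplicity p L dvd p ^ M * r" by (metis dvd_mult_left r(1))
      hence "p ^ multiplicity p L dvd p ^ M"
        using r(2) p by (metis coprime_commute coprime_power_left_iff prime_imp_coprime coprime_dvd_mult_left_iff)
      hence "multiplicity p L \<le> M" using p by (metis power_dvd_imp_le prime_gt_1_nat)
      thus False using lt by simp
    qed
    then obtain m where m: "m \<in> {1..n}" "multiplicity p L \<le> multiplicity p m" by blast
    have "p ^ multiplicity p L dvd m" using m(2) by (rule multiplicity_dvd')
    thus ?thesis using m(1) by (meson atLeastAtMost_iff dvd_imp_le le_trans less_le_trans zero_less_one)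
  qed
  have sub: "prime_factors L \<subseteq> S"
  proof
    fix p assume p: "p \<in> prime_factors L"
    hence "p dvd p ^ multiplicity p L"
      by (intro dvd_power) (auto simp: prime_factors_multiplicity)
    hence "p \<le> p ^ multiplicity p L" using p
      by (intro dvd_imp_le) (auto simp: prime_gt_0_nat in_prime_factors_iff)
    thus "p \<in> S" unfolding S_def using le[of p] p by (auto simp: in_prime_factors_iff)
  qed
  have "L = (\<Prod>p\<in>prime_factors L. p ^ multiplicity p L)"
    using prime_factorization_nat[of L] L0 by simp
  also have "\<dots> \<le> (\<Prod>p\<in>prime_factors L. n)"
    by (intro prod_mono) (auto intro!: le simp: in_prime_factors_iff)
  also have "\<dots> = n ^ card (prime_factors L)" by simp
  also have "\<dots> \<le> n ^ card S"
    using sub fin assms by (intro power_increasing card_mono) auto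
  finally show ?thesis by (simp add: L_def S_def)
qed

text \<open>For n = floor(x/2), \<open>4 ^ n / 2\<close> is at most \<open>n\<close> times the
  central binomial coefficient, hence at most \<open>x\<close> to the number of primes. In
  logarithms the rounding costs 2 and the factor 1/2 costs 1, whence \<open>x - 3\<close>.\<close>

lemma prime_count_lower:
  assumes x: "x \<ge> 4"
  shows "(x - 3) / log 2 x \<le> real (card {p::nat. prime p \<and> real p \<le> x})"
proof -
  define n where "n = nat \<lfloor>x / 2\<rfloor>"
  have n2: "n \<ge> 2" using x unfolding n_def by linarith
  have nx: "real (2 * n) \<le> x" "x < real (2 * n) + 2" using x unfolding n_def by linarith+
  let ?S = "{p::nat. prime p \<and> real p \<le> x}"
  have finS: "finite ?S"
    by (rule finite_subset[of _ "{..nat \<lfloor>x\<rfloor>}"]) (auto simp: le_nat_floor)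
  have "n * ((2 * n) choose n) \<le> Lcm {1..2 * n}"
    using mult_binomial_dvd_Lcm[of n "2 * n"] n2
    by (intro dvd_imp_le) (auto simp: Lcm_0_iff intro!: Nat.gr0I)
  also have "Lcm {1..2 * n} \<le> (2 * n) ^ card {p. prime p \<and> p \<le> 2 * n}"
    using n2 by (intro Lcm_le_power_primes) simp
  also have "\<dots> \<le> (2 * n) ^ card ?S"
  proof (intro power_increasing card_mono finS)
    show "{p. prime p \<and> p \<le> 2 * n} \<subseteq> ?S" using nx(1) of_nat_mono order_trans by blast
  qed (use n2 in simp)
  finally have le: "real (n * ((2 * n) choose n)) \<le> real ((2 * n) ^ card ?S)"
    by (rule of_nat_mono)
  have "4 ^ n \<le> 2 * real (n * ((2 * n) choose n))"
    using central_binomial_lower_bound[of n] n2 by (simp add: field_simps)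
  also have "\<dots> \<le> 2 * real ((2 * n) ^ card ?S)" using le by simp
  also have "\<dots> \<le> 2 * x ^ card ?S"
    using power_mono[OF nx(1), of "card ?S"] by simp
  finally have "4 ^ n \<le> 2 * x ^ card ?S" by simp
  hence "log 2 (4 ^ n) \<le> log 2 (2 * x ^ card ?S)"
    using x by (subst log_le_cancel_iff) auto
  also have "\<dots> = 1 + card ?S * log 2 x" using x by (simp add: log_mult log_nat_power)
  also have "log 2 (4 ^ n) = 2 * real n"
    using log_pow_cancel[of 2 "2 * n"] by (simp add: power_mult)
  finally have "x - 3 \<le> card ?S * log 2 x" using nx by simp
  moreover have "log 2 x > 0" using x by simp
  ultimately show ?thesis by (simp add: divide_le_eq)
qed

subsection \<open>Auxiliary facts on digits, cardinalities and growth\<close>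

lemma mixed_radix_less:
  fixes d b :: "nat \<Rightarrow> nat"
  assumes "\<And>j. j \<in> {1..n} \<Longrightarrow> d j < b j"
  shows "(\<Sum>j\<in>{1..n}. d j * (\<Prod>i\<in>{1..<j}. b i)) < (\<Prod>i\<in>{1..n}. b i)"
  using assms
proof (induction n)
  case (Suc n)
  let ?B = "\<Prod>i\<in>{1..n}. b i"
  have "(\<Sum>j\<in>{1..Suc n}. d j * (\<Prod>i\<in>{1..<j}. b i)) =
      (\<Sum>j\<in>{1..n}. d j * (\<Prod>i\<in>{1..<j}. b i)) + d (Suc n) * ?B"
    by (simp add: atLeastLessThanSuc_atLeastAtMost)
  also have "\<dots> < ?B + d (Suc n) * ?B" using Suc by simp
  also have "\<dots> = Suc (d (Suc n)) * ?B" by simp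
  also have "\<dots> \<le> b (Suc n) * ?B" using Suc.prems[of "Suc n"] by (intro mult_right_mono) auto
  finally show ?case by (simp add: mult.commute)
qed simp

text \<open>Reduction modulo the product of the lower bases separates the top digit from the
  rest.\<close>

lemma mixed_radix_unique:
  fixes d e b :: "nat \<Rightarrow> nat"
  assumes "\<And>j. j \<in> {1..n} \<Longrightarrow> d j < b j" "\<And>j. j \<in> {1..n} \<Longrightarrow> e j < b j"
    and "(\<Sum>j\<in>{1..n}. d j * (\<Prod>i\<in>{1..<j}. b i)) = (\<Sum>j\<in>{1..n}. e j * (\<Prod>i\<in>{1..<j}. b i))"
    and "j \<in> {1..n}"
  shows "d j = e j"
  using assms
proof (induction n)
  case (Suc n)
  let ?B = "\<Prod>i\<in>{1..n}. b i"
  let ?s = "\<lambda>d. \<Sum>j\<in>{1..n}. d j * (\<Prod>i\<in>{1..<j}. b i)"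
  have lt: "?s d < ?B" "?s e < ?B" using Suc.prems(1,2) by (auto intro!: mixed_radix_less simp del: One_nat_def)
  have eq: "?s d + d (Suc n) * ?B = ?s e + e (Suc n) * ?B"
    using Suc.prems(3) by (simp add: atLeastLessThanSuc_atLeastAtMost)
  have s: "?s d = ?s e" using arg_cong[OF eq, of "\<lambda>x. x mod ?B"] lt by simp
  have "?B \<noteq> 0" using lt by (metis not_less_zero)
  moreover have "d (Suc n) * ?B = e (Suc n) * ?B" using eq by (simp only: s add_left_cancel)
  ultimately have top: "d (Suc n) = e (Suc n)" using mult_right_cancel by blast
  show ?case
  proof (cases "j = Suc n")
    case False
    thus ?thesis using Suc.IH s Suc.prems(1,2,4) by simp
  qed (use top in simp)
qed simp

text \<open>Nonnegativity saves the factor 2 of the triangle inequality; the bounds on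
  \<open>s1\<close> and \<open>s2\<close> in \<open>sieve_set\<close> leave no room for it.\<close>

lemma abs_diff_nat_le:
  fixes x y :: nat
  assumes "real x \<le> b" "real y \<le> b"
  shows "real_of_int \<bar>int x - int y\<bar> \<le> b"
  using assms by (auto simp: abs_if)

lemma card_nat_le_real:
  assumes "S \<subseteq> {n::nat. 1 \<le> n \<and> real n \<le> b}" "b \<ge> 0"
  shows "finite S" "real (card S) \<le> b"
proof -
  have sub: "S \<subseteq> {1..nat \<lfloor>b\<rfloor>}" using assms by (auto simp: le_nat_floor)
  thus "finite S" by (rule finite_subset) simp
  have "card S \<le> nat \<lfloor>b\<rfloor>" using card_mono[OF _ sub] by simp
  thus "real (card S) \<le> b" using assms(2) by linarith
qed

lemma card_nonzero_int_le_real: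
  assumes "R \<ge> 0"
  shows "finite {s::int. 1 \<le> \<bar>s\<bar> \<and> real_of_int \<bar>s\<bar> \<le> R}"
    and "real (card {s::int. 1 \<le> \<bar>s\<bar> \<and> real_of_int \<bar>s\<bar> \<le> R}) \<le> 2 * R"
proof -
  let ?N = "{n::nat. 1 \<le> n \<and> real n \<le> R}" and ?S = "{s::int. 1 \<le> \<bar>s\<bar> \<and> real_of_int \<bar>s\<bar> \<le> R}"
  note N = card_nat_le_real[OF order_refl assms]
  have sub: "?S \<subseteq> int ` ?N \<union> (\<lambda>n. - int n) ` ?N"
  proof
    fix s :: int assume s: "s \<in> ?S"
    have "nat \<bar>s\<bar> \<in> ?N" using s by auto
    moreover have "s = int (nat \<bar>s\<bar>) \<or> s = - int (nat \<bar>s\<bar>)" by auto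
    ultimately show "s \<in> int ` ?N \<union> (\<lambda>n. - int n) ` ?N" by blast
  qed
  have fin: "finite (int ` ?N \<union> (\<lambda>n. - int n) ` ?N)" using N by simp
  show "finite ?S" using sub fin by (rule finite_subset)
  have "card ?S \<le> card (int ` ?N) + card ((\<lambda>n. - int n) ` ?N)"
    using card_mono[OF fin sub] card_Un_le le_trans by blast
  also have "\<dots> \<le> card ?N + card ?N" using N by (intro add_mono card_image_le) auto
  finally show "real (card ?S) \<le> 2 * R" using N(2) by linarith
qed

text \<open>This limits how many primes a single element of the sieve set can make bad.\<close>

lemma two_power_card_prime_divisors_le:
  assumes "n \<noteq> 0" "\<And>p. p \<in> S \<Longrightarrow> prime p \<and> p dvd n"
  shows "2 ^ card S \<le> (n::nat)"
proof -
  have "S \<subseteq> prime_factors n" using assms by (auto simp: in_prime_factors_iff)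
  hence "(2::nat) ^ card S \<le> 2 ^ card (prime_factors n)"
    by (intro power_increasing card_mono) auto
  also have "\<dots> = (\<Prod>p\<in>prime_factors n. 2)" by simp
  also have "\<dots> \<le> (\<Prod>p\<in>prime_factors n. p ^ multiplicity p n)"
  proof (intro prod_mono conjI)
    fix p assume p: "p \<in> prime_factors n"
    hence "2 \<le> p" by (auto simp: in_prime_factors_iff prime_ge_2_nat)
    also have "p ^ 1 \<le> p ^ multiplicity p n"
      using p \<open>2 \<le> p\<close> by (intro power_increasing) (auto simp: prime_factors_multiplicity)
    finally show "2 \<le> p ^ multiplicity p n" by simp
  qed simp
  also have "\<dots> = n" using prime_factorization_nat[of n] assms(1) by simp
  finally show ?thesis .
qed

lemma powr_real_nat: "2 powr real n = real (2 ^ n)"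
  by (simp add: powr_realpow)

text \<open>The right-hand side is a lower bound for the primes in block \<open>k\<close>, less the
  bad primes and \<open>F\<close> exceptions. Its first term is 2^(ck^2) up to a factor polynomial
  in \<open>k\<close>; the others are smaller by factors exponential in \<open>k\<close>, so giving
  away a factor 2^(-k) absorbs everything.\<close>

lemma block_growth:
  fixes c F :: real
  assumes "c > 0"
  shows "\<forall>\<^sub>F k::nat in at_top. 2 powr (c * (real k)\<^sup>2 - real k) \<le>
    (2 powr (c * (real k)\<^sup>2 - 3) - 3) / (c * (real k)\<^sup>2 - 3) - 2 powr (c * (real k - 1)\<^sup>2 - 3)
    - real k ^ 3 * 2 powr (c * (real k)\<^sup>2 - real k / 5) - F"
  using assms by real_asymp

subsection \<open>The Sidon property\<close>

locale sidon_parameters =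
  fixes c :: real and q g :: "nat \<Rightarrow> nat"
  assumes c_def: "c = sqrt 2 - 1"
    and q_prime: "\<And>j. j \<ge> 1 \<Longrightarrow> prime (q j)"
    and q_bounds: "\<And>j. j \<ge> 1 \<Longrightarrow> 2 ^ (2 * j - 1) < q j \<and> q j \<le> 2 ^ (2 * j + 1)"
    and g_primroot: "\<And>j. j \<ge> 1 \<Longrightarrow> residue_primroot (q j) (g j)"
begin

definition good_defined :: "nat set" where
  "good_defined = {p \<in> good_primes c q. term_defined c q g p}"

abbreviation lv :: "nat \<Rightarrow> nat" where "lv \<equiv> level c"
abbreviation dg :: "nat \<Rightarrow> nat \<Rightarrow> nat" where "dg \<equiv> digit c q g"
abbreviation a :: "nat \<Rightarrow> nat" where "a \<equiv> sidon_term c q g"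

section \<open>Size of the constants and of the products of moduli\<close>

text \<open>The enclosure has to be fine enough for \<open>\<alpha>_bounds\<close>, which amounts to
  \<open>c\<close> lying between 25/61 and 289/689.\<close>

lemma c_bounds: "41 / 100 < c" "c < 5 / 12"
proof -
  have "141 / 100 < sqrt 2" by (rule real_less_rsqrt) (simp add: power2_eq_square)
  thus "41 / 100 < c" by (simp add: c_def)
  have "sqrt 2 < 17 / 12" by (rule real_less_lsqrt) (auto simp: power2_eq_square)
  thus "c < 5 / 12" by (simp add: c_def)
qed

lemma c_square: "c\<^sup>2 = 1 - 2 * c"
  by (simp add: c_def power2_eq_square algebra_simps)

lemma q_gt_2:
  assumes "j \<ge> 1"
  shows "2 < q j"
proof -
  have "(2::nat) ^ 1 \<le> 2 ^ (2 * j - 1)" using assms by (intro power_increasing) auto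
  thus ?thesis using q_bounds[OF assms] by simp
qed

lemma q_strict_mono:
  assumes "1 \<le> i" "i < j"
  shows "q i < q j"
proof -
  have "q i \<le> 2 ^ (2 * i + 1)" using q_bounds assms by simp
  also have "\<dots> \<le> 2 ^ (2 * j - 1)" using assms by (intro power_increasing) auto
  also have "\<dots> < q j" using q_bounds assms by simp
  finally show ?thesis .
qed

text \<open>The exponents 2i - 1 sum to n^2.\<close>

lemma prod_q_lower: "2 ^ (n\<^sup>2) \<le> (\<Prod>i\<in>{1..n}. q i)"
proof (induction n)
  case (Suc n)
  have "(2::nat) ^ ((Suc n)\<^sup>2) = 2 ^ (n\<^sup>2) * 2 ^ (2 * Suc n - 1)"
    by (simp add: power_add[symmetric] power2_eq_square)
  also have "\<dots> \<le> (\<Prod>i\<in>{1..n}. q i) * q (Suc n)"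
    using Suc q_bounds[of "Suc n"] by (intro mult_mono) auto
  finally show ?case by (simp add: mult.commute)
qed simp

text \<open>The factor \<open>4 * q i\<close> is at most 2^(2i + 3), and these exponents sum to n^2
  + 4n.\<close>

lemma prod_4q_upper: "(\<Prod>i\<in>{1..n}. 4 * q i) \<le> 2 ^ (n\<^sup>2 + 4 * n)"
proof (induction n)
  case (Suc n)
  have "(\<Prod>i\<in>{1..Suc n}. 4 * q i) = (\<Prod>i\<in>{1..n}. 4 * q i) * (4 * q (Suc n))"
    by (simp add: mult.commute)
  also have "\<dots> \<le> 2 ^ (n\<^sup>2 + 4 * n) * (2 ^ 2 * 2 ^ (2 * Suc n + 1))"
    using Suc q_bounds[of "Suc n"] by (intro mult_mono) auto
  also have "\<dots> = 2 ^ ((Suc n)\<^sup>2 + 4 * Suc n)"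
    unfolding power_add[symmetric] by (rule arg_cong[of _ _ "\<lambda>x. 2 ^ x"]) (simp add: power2_eq_square)
  finally show ?case .
qed simp

lemma cong_prod_q:
  assumes "\<And>j. j \<in> J \<Longrightarrow> j \<ge> 1" "\<And>j. j \<in> J \<Longrightarrow> [x = y] (mod q j)"
  shows "[x = y] (mod (\<Prod>j\<in>J. q j))"
proof (rule coprime_cong_prod_nat)
  fix i j assume "i \<in> J" "j \<in> J" "i \<noteq> j"
  moreover have "q i \<noteq> q j"
    using q_strict_mono[of i j] q_strict_mono[of j i] calculation assms(1) by (metis less_irrefl linorder_neqE_nat)
  ultimately show "coprime (q i) (q j)" using assms(1) q_prime by (simp add: primes_coprime)
qed (use assms in auto)

lemma prime_block_upper: "p \<in> prime_block c k \<Longrightarrow> real p \<le> 2 powr (c * (real k)\<^sup>2 - 3)"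
  by (simp add: prime_block_def)

text \<open>Together with \<open>prod_q_lower\<close> this puts a prime of level \<open>k\<close>
  below the product of the first \<open>k\<close> moduli, so its residues determine it.\<close>

lemma prime_block_less:
  assumes "p \<in> prime_block c k"
  shows "p < 2 ^ (k\<^sup>2)"
proof -
  have "c * (real k)\<^sup>2 \<le> 1 * (real k)\<^sup>2" using c_bounds by (intro mult_right_mono) auto
  hence "2 powr (c * (real k)\<^sup>2 - 3) < (2::real) powr (real (k\<^sup>2))"
    by (intro powr_less_mono) auto
  also have "\<dots> = real (2 ^ (k\<^sup>2))" by (subst powr_realpow) auto
  finally show ?thesis using prime_block_upper[OF assms] by linarith
qed

section \<open>Digits of the terms\<close>

lemma good_definedD:
  assumes "p \<in> good_defined"
  shows "2 \<le> lv p" "p \<in> prime_block c (lv p)" "p \<notin> bad_primes c q (lv p)" "prime p"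
    "term_defined c q g p"
proof -
  obtain k where k: "2 \<le> k" "p \<in> prime_block c k" "p \<notin> bad_primes c q k"
    using assms by (auto simp: good_defined_def good_primes_def)
  have "lv p = k" using level_eq[of c k p] k c_bounds by simp
  thus "2 \<le> lv p" "p \<in> prime_block c (lv p)" "p \<notin> bad_primes c q (lv p)" using k by auto
  show "prime p" using k by (simp add: prime_block_def)
  show "term_defined c q g p" using assms by (simp add: good_defined_def)
qed

lemma is_digit_dg:
  assumes p: "p \<in> good_defined" and j: "j \<in> {1..lv p}"
  shows "is_digit q g j p (dg j p)"
proof -
  have "\<exists>!x. is_digit q g j p x"
    using ex1_digit_iff[of q j g p] q_prime q_gt_2 g_primroot good_definedD[OF p] j
    by (auto simp: term_defined_def)
  from theI'[OF this] show ?thesis using j by (simp add: digit_def)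
qed

lemma dg_bounds:
  assumes "p \<in> good_defined"
  shows "j \<in> {1..lv p} \<Longrightarrow> q j + 1 \<le> dg j p" "j \<in> {1..lv p} \<Longrightarrow> [g j ^ dg j p = p] (mod q j)"
    "j > lv p \<Longrightarrow> dg j p = 0" "j \<ge> 1 \<Longrightarrow> dg j p \<le> 2 * q j - 1"
proof -
  show "j > lv p \<Longrightarrow> dg j p = 0" by (simp add: digit_def)
  thus "j \<ge> 1 \<Longrightarrow> dg j p \<le> 2 * q j - 1"
    using is_digit_dg[OF assms, of j] by (cases "j > lv p") (auto simp: is_digit_def)
qed (use is_digit_dg[OF assms, of j] in \<open>auto simp: is_digit_def\<close>)

text \<open>Zero digits above the level pad the expansion, so terms of different levels can be
  compared at one common length.\<close>

lemma sidon_term_eq: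
  assumes "lv p \<le> n"
  shows "a p = (\<Sum>j\<in>{1..n}. dg j p * (\<Prod>i\<in>{1..<j}. 4 * q i))"
  unfolding sidon_term_def using assms
  by (intro sum.mono_neutral_left) (auto simp: digit_def)

text \<open>Every digit is below \<open>2 * q j\<close>, so no carry occurs in base \<open>4 * q j\<close>.\<close>

lemma dg_add_eq:
  assumes P: "p1 \<in> good_defined" "p2 \<in> good_defined" "p1' \<in> good_defined" "p2' \<in> good_defined"
    and eq: "a p1 + a p2 = a p1' + a p2'" and j: "j \<ge> 1"
  shows "dg j p1 + dg j p2 = dg j p1' + dg j p2'"
proof -
  define n where "n = lv p1 + lv p2 + lv p1' + lv p2' + j"
  have lt: "dg i x + dg i y < 4 * q i" if "i \<in> {1..n}" "x \<in> good_defined" "y \<in> good_defined" for i x y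
    using dg_bounds(4)[of x i] dg_bounds(4)[of y i] that q_gt_2[of i] by simp
  show ?thesis
  proof (rule mixed_radix_unique[where n = n and b = "\<lambda>i. 4 * q i"
      and d = "\<lambda>j. dg j p1 + dg j p2" and e = "\<lambda>j. dg j p1' + dg j p2'"])
    have "(\<Sum>j\<in>{1..n}. (dg j x + dg j y) * (\<Prod>i\<in>{1..<j}. 4 * q i)) = a x + a y"
      if "lv x \<le> n" "lv y \<le> n" for x y
      using sidon_term_eq[OF that(1)] sidon_term_eq[OF that(2)]
      by (simp add: sum.distrib add_mult_distrib)
    thus "(\<Sum>j\<in>{1..n}. (dg j p1 + dg j p2) * (\<Prod>i\<in>{1..<j}. 4 * q i)) =
          (\<Sum>j\<in>{1..n}. (dg j p1' + dg j p2') * (\<Prod>i\<in>{1..<j}. 4 * q i))"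
      using eq by (simp add: n_def)
    show "j \<in> {1..n}" using j by (simp add: n_def)
  qed (use lt P in auto)
qed

text \<open>The range of the digits makes levels visible: a nonzero digit at place j lies between
  q_j + 1 and 2 q_j - 1, so a digit sum is 0, lies in this range or is at least 2 q_j + 2 according
  to the number of terms having a digit there. Exchanging the two sides turns the inequalities into
  equalities.\<close>

lemma level_le_of_dg_add_eq:
  assumes P: "p1 \<in> good_defined" "p2 \<in> good_defined" "p1' \<in> good_defined" "p2' \<in> good_defined"
    and eq: "\<And>j. j \<ge> 1 \<Longrightarrow> dg j p1 + dg j p2 = dg j p1' + dg j p2'"
    and le: "lv p2 \<le> lv p1" "lv p2' \<le> lv p1'"
  shows "lv p1' \<le> lv p1" "lv p2' \<le> lv p2"
proof -
  show 1: "lv p1' \<le> lv p1"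
  proof (rule ccontr)
    assume *: "\<not> ?thesis"
    define j where "j = lv p1'"
    have "dg j p1 = 0" "dg j p2 = 0" "q j + 1 \<le> dg j p1'"
      using * le P good_definedD(1)[OF P(3)] by (auto simp only: j_def atLeastAtMost_iff intro!: dg_bounds)
    thus False using eq[of j] * by (simp add: j_def)
  qed
  show "lv p2' \<le> lv p2"
  proof (rule ccontr)
    assume *: "\<not> ?thesis"
    define j where "j = lv p2'"
    have "dg j p1 \<le> 2 * q j - 1" "dg j p2 = 0" "q j + 1 \<le> dg j p1'" "q j + 1 \<le> dg j p2'"
      using * le P good_definedD(1)[OF P(4)] by (auto simp only: j_def atLeastAtMost_iff intro!: dg_bounds)
    thus False using eq[of j] * by (simp add: j_def)
  qed
qed

text \<open>Equal digits give equal residues modulo each q_j up to the level, and both primes are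
  smaller than the product of these moduli.\<close>

lemma dg_inj:
  assumes P: "x \<in> good_defined" "y \<in> good_defined" "lv x = lv y"
    and eq: "\<And>j. j \<in> {1..lv x} \<Longrightarrow> dg j x = dg j y"
  shows "x = y"
proof -
  have "[x = y] (mod q j)" if "j \<in> {1..lv x}" for j
    using dg_bounds(2)[OF P(1), of j] dg_bounds(2)[OF P(2), of j] eq[OF that] that P(3)
    by (metis cong_sym cong_trans)
  hence "[x = y] (mod (\<Prod>j\<in>{1..lv x}. q j))" by (intro cong_prod_q) auto
  moreover have "x < (\<Prod>j\<in>{1..lv x}. q j)" "y < (\<Prod>j\<in>{1..lv x}. q j)"
    using prime_block_less good_definedD(2) P prod_q_lower less_le_trans by metis+
  ultimately show ?thesis by (rule cong_less_modulus_unique_nat)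
qed

section \<open>Uniqueness of the representation as a sum\<close>

lemma sidon_pairs_aux:
  assumes P: "p1 \<in> good_defined" "p2 \<in> good_defined" "p1' \<in> good_defined" "p2' \<in> good_defined"
    and sum: "a p1 + a p2 = a p1' + a p2'"
    and le: "lv p2 \<le> lv p1" "lv p2' \<le> lv p1'"
  shows "{p1, p2} = {p1', p2'}"
proof -
  note eq = dg_add_eq[OF P sum]
  note eq' = eq[symmetric]
  define k1 k2 where "k1 = lv p1" and "k2 = lv p2"
  have lvs: "lv p1' = k1" "lv p2' = k2"
    using level_le_of_dg_add_eq[OF P eq le] level_le_of_dg_add_eq[OF P(3,4,1,2) eq' le(2,1)]
    by (auto simp: k1_def k2_def)
  have k: "2 \<le> k2" "k2 \<le> k1" using good_definedD(1)[OF P(2)] le by (auto simp: k1_def k2_def)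
  have blk: "p1 \<in> prime_block c k1" "p1' \<in> prime_block c k1"
    "p2 \<in> prime_block c k2" "p2' \<in> prime_block c k2"
    using good_definedD(2) P lvs k1_def k2_def by metis+
  have pr: "prime p1" "prime p2" "prime p1'" "prime p2'" using good_definedD P by auto
  define Q1 Q2 where "Q1 = (\<Prod>i\<in>{1..k2}. q i)" and "Q2 = (\<Prod>i\<in>{k2+1..k1}. q i)"
  have Q0: "Q1 > 0" "Q2 > 0"
    unfolding Q1_def Q2_def using q_prime prime_gt_0_nat by (auto intro!: prod_pos)
  \<comment> \<open>The first three cases are degenerate; the three inequalities of the last one
    make \<open>s2\<close>, \<open>s\<close> and \<open>s1\<close>, in this order, nonzero.\<close>
  consider "p1 = p1'" | "p2 = p2'" | "p1 * p2 = p1' * p2'"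
    | "p1 \<noteq> p1'" "p2 \<noteq> p2'" "p1 * p2 \<noteq> p1' * p2'" by blast
  thus ?thesis
  proof cases
    case 1
    hence "p2 = p2'" using dg_inj[of p2 p2'] P eq lvs k2_def by force
    thus ?thesis using 1 by simp
  next
    case 2
    hence "p1 = p1'" using dg_inj[of p1 p1'] P eq lvs k1_def by force
    thus ?thesis using 2 by simp
  next
    case 3
    hence "p1 dvd p1' * p2'" by (metis dvd_triv_left)
    hence "p1 = p1' \<or> p1 = p2'" using pr by (metis prime_dvd_mult_iff primes_dvd_imp_eq)
    thus ?thesis using 3 pr by (auto simp: prime_gt_0_nat mult.commute)
  next
    case 4
    have "[p1 * p2 = p1' * p2'] (mod Q1)"
      unfolding Q1_def
    proof (rule cong_prod_q)
      fix j assume j: "j \<in> {1..k2}"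
      \<comment> \<open>Digits are discrete logarithms, so a digit sum is a logarithm of the product
        of the two primes.\<close>
      have "[g j ^ (dg j x + dg j y) = x * y] (mod q j)"
        if "x \<in> good_defined" "y \<in> good_defined" "k2 \<le> lv x" "k2 \<le> lv y" for x y
        unfolding power_add using that j by (intro cong_mult dg_bounds) auto
      from this[of p1 p2] this[of p1' p2'] show "[p1 * p2 = p1' * p2'] (mod q j)"
        using P k lvs eq[of j] j k1_def k2_def by (metis atLeastAtMost_iff cong_sym cong_trans le_refl)
    qed auto
    hence "int Q1 dvd int (p1 * p2) - int (p1' * p2')"
      by (simp only: cong_int_iff[symmetric] cong_iff_dvd_diff)
    then obtain s1 where s1: "int (p1 * p2) - int (p1' * p2') = s1 * int Q1"
      by (metis dvdE mult.commute)
    have "[p1 = p1'] (mod Q2)"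
      unfolding Q2_def
    proof (rule cong_prod_q)
      fix j assume j: "j \<in> {k2+1..k1}"
      \<comment> \<open>Above place \<open>k2\<close> the second prime has no digit, so the digit
        sum is a logarithm of the first prime alone.\<close>
      have "dg j p2 = 0" "dg j p2' = 0" using j P lvs k2_def by (auto intro!: dg_bounds)
      hence "dg j p1 = dg j p1'" using eq[of j] j by simp
      moreover have "[g j ^ dg j p1 = p1] (mod q j)" "[g j ^ dg j p1' = p1'] (mod q j)"
        using j P lvs k1_def by (auto intro!: dg_bounds)
      ultimately show "[p1 = p1'] (mod q j)" by (metis cong_sym cong_trans)
    qed auto
    hence "[p1' = p1] (mod Q2)" by (rule cong_sym)
    hence "int Q2 dvd int p1' - int p1"
      by (simp only: cong_int_iff[symmetric] cong_iff_dvd_diff)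
    then obtain s2 where s2: "int p1' - int p1 = s2 * int Q2"
      by (metis dvdE mult.commute)
    define s where "s = s1 * int Q1 + s2 * int p2' * int Q2"
    have s: "s = int p1 * (int p2 - int p2')"
    proof -
      have "s = (int (p1 * p2) - int (p1' * p2')) + (int p1' - int p1) * int p2'"
        unfolding s1 s2 s_def by simp
      thus ?thesis by (simp add: algebra_simps)
    qed
    have nz: "s1 \<noteq> 0" "s2 \<noteq> 0" "s \<noteq> 0"
      using s1 s2 s 4 pr by (auto simp del: of_nat_mult)
    define R where "R = 2 powr (c * ((real k1)\<^sup>2 + (real k2)\<^sup>2) - 6)"
    have R: "R = 2 powr (c * (real k1)\<^sup>2 - 3) * 2 powr (c * (real k2)\<^sup>2 - 3)"
      by (simp add: R_def powr_add[symmetric] algebra_simps)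
    have "real (p1 * p2) \<le> R" "real (p1' * p2') \<le> R"
      unfolding R of_nat_mult using blk by (auto intro!: mult_mono prime_block_upper)
    hence "real_of_int \<bar>s1 * int Q1\<bar> \<le> R"
      unfolding s1[symmetric] by (rule abs_diff_nat_le)
    hence s1R: "real_of_int \<bar>s1\<bar> \<le> R / real Q1"
      using Q0 by (simp add: abs_mult field_simps)
    have "real_of_int \<bar>s2 * int Q2\<bar> \<le> 2 powr (c * (real k1)\<^sup>2 - 3)"
      unfolding s2[symmetric] using blk by (intro abs_diff_nat_le prime_block_upper)
    hence s2R: "real_of_int \<bar>s2\<bar> \<le> 2 powr (c * (real k1)\<^sup>2 - 3) / real Q2"
      using Q0 by (simp add: abs_mult field_simps)
    \<comment> \<open>For larger \<open>k2\<close> the bound \<open>R\<close> falls below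
      \<open>Q1\<close>, which would force \<open>s1 = 0\<close>.\<close>
    have k21: "(real k2)\<^sup>2 < c / (1 - c) * (real k1)\<^sup>2"
    proof (rule ccontr)
      assume "\<not> ?thesis"
      hence "c * (real k1)\<^sup>2 \<le> (1 - c) * (real k2)\<^sup>2"
        using c_bounds by (simp add: field_simps)
      hence "c * ((real k1)\<^sup>2 + (real k2)\<^sup>2) - 6 < real (k2\<^sup>2)" by (simp add: algebra_simps)
      hence "R < 2 powr real (k2\<^sup>2)" unfolding R_def by (intro powr_less_mono) auto
      also have "\<dots> = real (2 ^ (k2\<^sup>2))" by (subst powr_realpow) auto
      also have "\<dots> \<le> real Q1" unfolding Q1_def using prod_q_lower by (rule of_nat_mono)
      finally have "R / real Q1 < 1" using Q0 by simp
      thus False using s1R nz(1) by linarith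
    qed
    \<comment> \<open>As c / (1 - c) < 1, the case of equal levels is excluded too:
      \<open>k2 < k1\<close> is part of \<open>bad_primes\<close>.\<close>
    have "c / (1 - c) * (real k1)\<^sup>2 \<le> 1 * (real k1)\<^sup>2"
      using c_bounds by (intro mult_right_mono) (auto simp: field_simps)
    hence "real k2 < real k1" using k21 by (intro power2_less_imp_less[of "real k2"]) auto
    moreover have "s \<in> sieve_set c q k2 k1"
      unfolding sieve_set_def Let_def Q1_def[symmetric] Q2_def[symmetric] R_def[symmetric] s_def
      using nz s1R s2R blk(4) by (intro CollectI exI[of _ s1] exI[of _ s2] exI[of _ p2']) auto
    moreover have "int p1 dvd s" using s by simp
    ultimately have "p1 \<in> bad_primes c q k1"
      unfolding bad_primes_def using blk(1) k(1) k21 nz(3) by auto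
    thus ?thesis using good_definedD(3)[OF P(1)] k1_def by simp
  qed
qed

lemma sidon_pairs:
  assumes P: "p1 \<in> good_defined" "p2 \<in> good_defined" "p1' \<in> good_defined" "p2' \<in> good_defined"
    and sum: "a p1 + a p2 = a p1' + a p2'"
  shows "{p1, p2} = {p1', p2'}"
  using sidon_pairs_aux[OF P] sidon_pairs_aux[OF P(2,1,3,4)] sidon_pairs_aux[OF P(1,2,4,3)]
    sidon_pairs_aux[OF P(2,1,4,3)] sum
  by (metis add.commute insert_commute linear)

lemma sidon_term_inj_on: "inj_on a good_defined"
  using sidon_pairs by (intro inj_onI) (metis doubleton_eq_iff)

lemma sidon_set_image: "sidon_set (a ` good_defined)"
  unfolding sidon_set_def
proof safe
  fix p1 p2 p1' p2' assume P: "p1 \<in> good_defined" "p2 \<in> good_defined" "p1' \<in> good_defined" "p2' \<in> good_defined"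
    and le: "a p1 \<le> a p2" "a p1' \<le> a p2'" and sum: "a p1 + a p2 = a p1' + a p2'"
  have "{p1, p2} = {p1', p2'}" using sidon_pairs P sum by blast
  thus "a p1 = a p1'" "a p2 = a p2'" using le by (auto simp: doubleton_eq_iff)
qed

subsection \<open>The counting function\<close>


text \<open>The leading digit exceeds q_k and its weight is at least the product of the lower
  moduli, so it alone contributes enough.\<close>

lemma sidon_term_lower:
  assumes "p \<in> good_defined"
  shows "2 ^ ((lv p)\<^sup>2) \<le> a p"
proof -
  define k where "k = lv p"
  have k: "k \<ge> 2" using good_definedD[OF assms] by (simp add: k_def)
  have "2 ^ (k\<^sup>2) \<le> (\<Prod>i\<in>{1..k}. q i)" by (rule prod_q_lower)
  also have "{1..k} = insert k {1..<k}" using k by auto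
  also have "(\<Prod>i\<in>insert k {1..<k}. q i) = q k * (\<Prod>i\<in>{1..<k}. q i)" by simp
  also have "\<dots> \<le> dg k p * (\<Prod>i\<in>{1..<k}. 4 * q i)"
    using dg_bounds(1)[OF assms, of k] k by (intro mult_mono prod_mono) (auto simp: k_def)
  also have "\<dots> \<le> a p"
    unfolding sidon_term_def k_def[symmetric]
    using k by (intro member_le_sum[where f = "\<lambda>j. dg j p * (\<Prod>i\<in>{1..<j}. 4 * q i)"]) auto
  finally show ?thesis by (simp add: k_def)
qed

lemma sidon_term_upper:
  assumes "p \<in> good_defined"
  shows "a p < 2 ^ ((lv p)\<^sup>2 + 4 * lv p)"
proof -
  have "a p < (\<Prod>i\<in>{1..lv p}. 4 * q i)"
    unfolding sidon_term_def
  proof (rule mixed_radix_less)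
    fix j assume "j \<in> {1..lv p}"
    thus "dg j p < 4 * q j" using dg_bounds(4)[OF assms, of j] q_gt_2[of j] by simp
  qed
  thus ?thesis using prod_4q_upper less_le_trans by blast
qed

text \<open>At level k, p \<le> 2^(ck^2) \<le> a_p^c \<le> x^c, and counting all integers up to x^c
  is enough.\<close>

lemma count_upper:
  assumes x: "x \<ge> 1"
  shows "finite {p \<in> good_defined. real (a p) \<le> x}"
    and "real (card {p \<in> good_defined. real (a p) \<le> x}) \<le> x powr c"
proof -
  have "{p \<in> good_defined. real (a p) \<le> x} \<subseteq> {n. 1 \<le> n \<and> real n \<le> x powr c}"
  proof safe
    fix p assume p: "p \<in> good_defined" and le: "real (a p) \<le> x"
    show "1 \<le> p" using good_definedD(4)[OF p] by (rule prime_ge_1_nat)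
    have "real p \<le> 2 powr (c * (real (lv p))\<^sup>2 - 3)"
      using prime_block_upper good_definedD(2)[OF p] by blast
    also have "\<dots> \<le> (2 powr real ((lv p)\<^sup>2)) powr c" by (simp add: powr_powr mult.commute)
    also have "\<dots> \<le> x powr c"
    proof (intro powr_mono2)
      have "real (2 ^ ((lv p)\<^sup>2)) \<le> real (a p)" using sidon_term_lower[OF p] by (rule of_nat_mono)
      thus "2 powr real ((lv p)\<^sup>2) \<le> x" unfolding powr_real_nat using le by linarith
    qed (use c_bounds in auto)
    finally show "real p \<le> x powr c" .
  qed
  from card_nat_le_real[OF this] show "finite {p \<in> good_defined. real (a p) \<le> x}"
    "real (card {p \<in> good_defined. real (a p) \<le> x}) \<le> x powr c" by simp_all
qed

section \<open>Size of the sieve set\<close>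

lemma card_prime_block_upper:
  "finite (prime_block c k)" "real (card (prime_block c k)) \<le> 2 powr (c * (real k)\<^sup>2 - 3)"
proof -
  have "prime_block c k \<subseteq> {n. 1 \<le> n \<and> real n \<le> 2 powr (c * (real k)\<^sup>2 - 3)}"
    by (auto simp: prime_block_def Suc_le_eq prime_gt_0_nat)
  from card_nat_le_real[OF this]
  show "finite (prime_block c k)" "real (card (prime_block c k)) \<le> 2 powr (c * (real k)\<^sup>2 - 3)"
    by simp_all
qed

text \<open>The triples (s1, s2, p2) are counted. Each signed range contributes a factor 2, so the
  exponents -6 - 3 - 3 become -10, and division by \<open>Q1 * Q2\<close>, which is at least
  2^(k1^2), gives the term -k1^2.\<close>

lemma card_sieve_set_upper:
  assumes "k2 \<le> k1"
  shows "finite (sieve_set c q k2 k1)"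
    and "real (card (sieve_set c q k2 k1)) \<le> 2 powr ((2 * c - 1) * (real k1)\<^sup>2 + 2 * c * (real k2)\<^sup>2 - 10)"
proof -
  define Q1 Q2 where "Q1 = (\<Prod>i\<in>{1..k2}. q i)" and "Q2 = (\<Prod>i\<in>{k2+1..k1}. q i)"
  have Q0: "Q1 > 0" "Q2 > 0"
    unfolding Q1_def Q2_def using q_prime prime_gt_0_nat by (auto intro!: prod_pos)
  have "Q1 * Q2 = (\<Prod>i\<in>{1..k1}. q i)"
    unfolding Q1_def Q2_def using assms by (subst prod.union_disjoint[symmetric]) (auto intro: prod.cong)
  hence Q: "2 powr (real k1)\<^sup>2 \<le> real (Q1 * Q2)"
    using of_nat_mono[OF prod_q_lower[of k1], where 'a = real] powr_real_nat[of "k1\<^sup>2"] by simp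
  define R1 R2 where "R1 = 2 powr (c * ((real k1)\<^sup>2 + (real k2)\<^sup>2) - 6) / real Q1"
    and "R2 = 2 powr (c * (real k1)\<^sup>2 - 3) / real Q2"
  have R0: "R1 \<ge> 0" "R2 \<ge> 0" by (auto simp: R1_def R2_def)
  define I where "I R = {s::int. 1 \<le> \<bar>s\<bar> \<and> real_of_int \<bar>s\<bar> \<le> R}" for R
  note I = card_nonzero_int_le_real[folded I_def]
  let ?T = "I R1 \<times> I R2 \<times> prime_block c k2"
  have img: "sieve_set c q k2 k1 = (\<lambda>(s1, s2, p). s1 * int Q1 + s2 * int p * int Q2) ` ?T"
    unfolding sieve_set_def Let_def Q1_def[symmetric] Q2_def[symmetric] R1_def[symmetric] R2_def[symmetric] I_def
    by (auto simp: image_iff) blast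
  have fin: "finite ?T" using I R0 card_prime_block_upper(1) by simp
  thus "finite (sieve_set c q k2 k1)" unfolding img by simp
  have "real (card (sieve_set c q k2 k1)) \<le> real (card ?T)"
    unfolding img using card_image_le[OF fin] by simp
  also have "\<dots> \<le> (2 * R1) * ((2 * R2) * 2 powr (c * (real k2)\<^sup>2 - 3))"
    unfolding card_cartesian_product of_nat_mult
    using I R0 card_prime_block_upper(2) by (intro mult_mono) auto
  also have "\<dots> = 2 powr (2 * c * ((real k1)\<^sup>2 + (real k2)\<^sup>2) - 10) / real (Q1 * Q2)"
  proof -
    have "2 * (2 * (2 powr (c * ((real k1)\<^sup>2 + (real k2)\<^sup>2) - 6) *
        (2 powr (c * (real k1)\<^sup>2 - 3) * 2 powr (c * (real k2)\<^sup>2 - 3)))) =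
        4 * 2 powr (2 * c * ((real k1)\<^sup>2 + (real k2)\<^sup>2) - 12)"
      unfolding powr_add[symmetric] by (simp add: algebra_simps)
    also have "(4::real) = 2 powr 2" by simp
    also have "2 powr 2 * 2 powr (2 * c * ((real k1)\<^sup>2 + (real k2)\<^sup>2) - 12) =
        (2 powr (2 * c * ((real k1)\<^sup>2 + (real k2)\<^sup>2) - 10) :: real)"
      unfolding powr_add[symmetric] by simp
    finally show ?thesis by (simp add: R1_def R2_def mult_ac)
  qed
  also have "\<dots> \<le> 2 powr (2 * c * ((real k1)\<^sup>2 + (real k2)\<^sup>2) - 10) / 2 powr (real k1)\<^sup>2"
    using Q Q0 by (intro divide_left_mono) auto
  also have "\<dots> = 2 powr ((2 * c - 1) * (real k1)\<^sup>2 + 2 * c * (real k2)\<^sup>2 - 10)"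
    unfolding powr_diff[symmetric] by (simp add: algebra_simps)
  finally show "real (card (sieve_set c q k2 k1)) \<le> \<dots>" .
qed

text \<open>The bound limits each nonzero element to k1^2 prime divisors. Both summands are at most
  \<open>R\<close> in absolute value, and c < 1/2 keeps 2R below 2^(k1^2).\<close>

lemma sieve_set_abs_le:
  assumes s: "s \<in> sieve_set c q k2 k1" and "k2 \<le> k1"
  shows "nat \<bar>s\<bar> \<le> 2 ^ (k1\<^sup>2)"
proof -
  define Q1 Q2 where "Q1 = (\<Prod>i\<in>{1..k2}. q i)" and "Q2 = (\<Prod>i\<in>{k2+1..k1}. q i)"
  have Q0: "Q1 > 0" "Q2 > 0"
    unfolding Q1_def Q2_def using q_prime prime_gt_0_nat by (auto intro!: prod_pos)
  define R where "R = 2 powr (c * ((real k1)\<^sup>2 + (real k2)\<^sup>2) - 6)"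
  obtain s1 s2 p where s: "s = s1 * int Q1 + s2 * int p * int Q2"
    and s1: "real_of_int \<bar>s1\<bar> \<le> R / real Q1"
    and s2: "real_of_int \<bar>s2\<bar> \<le> 2 powr (c * (real k1)\<^sup>2 - 3) / real Q2"
    and p: "p \<in> prime_block c k2"
    using s unfolding sieve_set_def Let_def Q1_def[symmetric] Q2_def[symmetric] R_def[symmetric] by blast
  have 1: "real_of_int \<bar>s1\<bar> * real Q1 \<le> R" using s1 Q0 by (simp add: field_simps)
  have "real_of_int \<bar>s2\<bar> * real Q2 * real p \<le> 2 powr (c * (real k1)\<^sup>2 - 3) * 2 powr (c * (real k2)\<^sup>2 - 3)"
    using s2 Q0 prime_block_upper[OF p] by (intro mult_mono) (auto simp: field_simps)
  also have "\<dots> = R" by (simp add: R_def powr_add[symmetric] algebra_simps)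
  finally have 2: "real_of_int \<bar>s2\<bar> * real Q2 * real p \<le> R" .
  have "real_of_int \<bar>s\<bar> \<le> real_of_int \<bar>s1 * int Q1\<bar> + real_of_int \<bar>s2 * int p * int Q2\<bar>"
    unfolding s by linarith
  also have "\<dots> \<le> 2 * R" using 1 2 by (simp add: abs_mult mult_ac)
  also have "\<dots> = 2 powr 1 * R" by simp
  also have "\<dots> \<le> 2 powr real (k1\<^sup>2)"
    unfolding R_def powr_add[symmetric]
  proof (intro powr_mono)
    have "c * ((real k1)\<^sup>2 + (real k2)\<^sup>2) \<le> (1 / 2) * ((real k1)\<^sup>2 + (real k1)\<^sup>2)"
      using assms(2) c_bounds by (intro mult_mono add_mono power_mono) auto
    thus "1 + (c * ((real k1)\<^sup>2 + (real k2)\<^sup>2) - 6) \<le> real (k1\<^sup>2)" by simp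
  qed simp
  finally have "real_of_int \<bar>s\<bar> \<le> real_of_int (2 ^ (k1\<^sup>2))" unfolding powr_real_nat by simp
  hence "\<bar>s\<bar> \<le> 2 ^ (k1\<^sup>2)" by (simp only: of_int_le_iff)
  thus ?thesis by (simp add: nat_le_iff)
qed

section \<open>The critical ratio of levels and the number of bad primes\<close>

definition \<alpha> :: real where "\<alpha> = sqrt (c / (1 - c))"

lemma \<alpha>_square: "\<alpha>\<^sup>2 = c / (1 - c)"
  unfolding \<alpha>_def using c_bounds by simp

lemma \<alpha>_bounds: "5 / 6 < \<alpha>" "\<alpha> < 17 / 20"
proof -
  show "5 / 6 < \<alpha>"
    unfolding \<alpha>_def using c_bounds by (intro real_less_rsqrt) (simp add: power2_eq_square field_simps)
  show "\<alpha> < 17 / 20"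
    unfolding \<alpha>_def using c_bounds by (intro real_less_lsqrt) (auto simp: power2_eq_square field_simps)
qed

text \<open>Equivalent to c^2 = 1 - 2c, whose positive root is sqrt 2 - 1: this choice of
  \<open>c\<close> balances the sieve exponent against that of the block.\<close>

lemma two_c_alpha_square: "2 * c * \<alpha>\<^sup>2 = 1 - c"
proof -
  have "2 * c * c = (1 - c) * (1 - c)" using c_square by (simp add: power2_eq_square algebra_simps)
  thus ?thesis unfolding \<alpha>_square using c_bounds by (simp add: field_simps)
qed

text \<open>A gap of width w suits \<open>spaced_or_spaced_Suc\<close> if \<alpha> + w \<le> 1; 3/20
  = 1 - 17/20 is what \<open>\<alpha>_bounds\<close> permits.\<close>

definition spaced :: "nat \<Rightarrow> bool" where
  "spaced k \<longleftrightarrow> (\<forall>l::nat. real l < \<alpha> * real k \<longrightarrow> real l \<le> \<alpha> * real k - 3 / 20)"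

text \<open>Integers in the gaps below \<alpha> k and \<alpha> (k + 1) would differ by more than
  \<alpha> - 3/20 > 0 and less than \<alpha> + 3/20 < 1.\<close>

lemma spaced_or_spaced_Suc: "spaced k \<or> spaced (Suc k)"
proof (rule ccontr)
  assume "\<not> ?thesis"
  then obtain l m :: nat where
    "real l < \<alpha> * real k" "\<alpha> * real k - 3 / 20 < real l"
    "real m < \<alpha> * real (Suc k)" "\<alpha> * real (Suc k) - 3 / 20 < real m"
    unfolding spaced_def by (meson not_le)
  hence "real l < real m" "real m < real (Suc l)" using \<alpha>_bounds by (auto simp: algebra_simps)
  thus False by (simp only: of_nat_less_iff)
qed

text \<open>Union bound over at most \<open>k\<close> smaller levels and the elements of each sieve
  set, each with at most k^2 prime divisors in the block. The exponential saving comes from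
  \<open>spaced\<close>.\<close>

lemma card_bad_primes_upper:
  assumes "spaced k"
  shows "real (card (bad_primes c q k)) \<le> real k ^ 3 * 2 powr (c * (real k)\<^sup>2 - real k / 5)"
proof -
  define K where "K = {l. 2 \<le> l \<and> l < k \<and> (real l)\<^sup>2 < c / (1 - c) * (real k)\<^sup>2}"
  have K: "K \<subseteq> {..<k}" by (auto simp: K_def)
  hence finK: "finite K" by (rule finite_subset) simp
  define D where "D s = {p \<in> prime_block c k. int p dvd s}" for s
  have finS: "finite (sieve_set c q l k - {0})" if "l \<in> K" for l
    using card_sieve_set_upper(1)[of l k] that K by auto
  have D: "card (D s) \<le> k\<^sup>2" if "l \<in> K" "s \<in> sieve_set c q l k - {0}" for l s
  proof -
    have "2 ^ card (D s) \<le> nat \<bar>s\<bar>"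
      using that(2) by (intro two_power_card_prime_divisors_le)
        (auto simp: D_def prime_block_def)
    also have "\<dots> \<le> 2 ^ (k\<^sup>2)" using that K by (intro sieve_set_abs_le) auto
    finally show ?thesis by (simp add: power_increasing_iff)
  qed
  have S: "real (card (sieve_set c q l k - {0})) \<le> 2 powr (c * (real k)\<^sup>2 - real k / 5)"
    if "l \<in> K" for l
  proof -
    have "(real l)\<^sup>2 < (\<alpha> * real k)\<^sup>2"
      using that by (simp add: K_def power_mult_distrib \<alpha>_square)
    hence "real l < \<alpha> * real k" by (rule power2_less_imp_less) (use \<alpha>_bounds in simp)
    hence "real l \<le> \<alpha> * real k - 3 / 20" using assms by (simp add: spaced_def)
    hence "(real l)\<^sup>2 \<le> (\<alpha> * real k - 3 / 20)\<^sup>2" by (intro power_mono) auto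
    hence "2 * c * (real l)\<^sup>2 \<le> 2 * c * (\<alpha> * real k - 3 / 20)\<^sup>2"
      using c_bounds by (intro mult_left_mono) auto
    \<comment> \<open>The gap 3/20 enters the square as a term linear in \<open>k\<close>, which is
      at least k/5 because c \<alpha> > 1/3; the -10 in the bound for the sieve set absorbs the
      constant 9c/200.\<close>
    also have "\<dots> = (2 * c * \<alpha>\<^sup>2) * (real k)\<^sup>2 - 3 / 5 * (c * \<alpha>) * real k + 9 / 200 * c"
      by (simp add: power2_eq_square algebra_simps)
    also have "\<dots> \<le> (1 - c) * (real k)\<^sup>2 - 3 / 5 * (1 / 3) * real k + 9 / 200 * c"
    proof -
      have "1 / 3 \<le> 41 / 100 * (5 / 6 :: real)" by simp
      also have "\<dots> \<le> c * \<alpha>" using c_bounds \<alpha>_bounds by (intro mult_mono) auto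
      finally have "1 / 3 * real k \<le> c * \<alpha> * real k" by (intro mult_right_mono) auto
      thus ?thesis unfolding two_c_alpha_square by simp
    qed
    finally have "(2 * c - 1) * (real k)\<^sup>2 + 2 * c * (real l)\<^sup>2 - 10 \<le> c * (real k)\<^sup>2 - real k / 5"
      using c_bounds by (simp add: algebra_simps)
    hence "2 powr ((2 * c - 1) * (real k)\<^sup>2 + 2 * c * (real l)\<^sup>2 - 10) \<le> (2::real) powr (c * (real k)\<^sup>2 - real k / 5)"
      by (intro powr_mono) auto
    moreover have "card (sieve_set c q l k - {0}) \<le> card (sieve_set c q l k)"
      by (rule card_Diff1_le)
    moreover have "real (card (sieve_set c q l k)) \<le> 2 powr ((2 * c - 1) * (real k)\<^sup>2 + 2 * c * (real l)\<^sup>2 - 10)"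
      using that K by (intro card_sieve_set_upper) auto
    ultimately show ?thesis by linarith
  qed
  have "bad_primes c q k \<subseteq> (\<Union>l\<in>K. \<Union>s\<in>sieve_set c q l k - {0}. D s)"
    unfolding bad_primes_def K_def D_def by blast
  moreover have "finite (\<Union>l\<in>K. \<Union>s\<in>sieve_set c q l k - {0}. D s)"
    by (rule finite_subset[OF _ card_prime_block_upper(1)[of k]]) (auto simp: D_def)
  ultimately have "card (bad_primes c q k) \<le> card (\<Union>l\<in>K. \<Union>s\<in>sieve_set c q l k - {0}. D s)"
    by (intro card_mono)
  also have "\<dots> \<le> (\<Sum>l\<in>K. card (\<Union>s\<in>sieve_set c q l k - {0}. D s))"
    by (rule card_UN_le[OF finK])
  also have "\<dots> \<le> (\<Sum>l\<in>K. card (sieve_set c q l k - {0}) * k\<^sup>2)"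
  proof (rule sum_mono)
    fix l assume l: "l \<in> K"
    have "card (\<Union>s\<in>sieve_set c q l k - {0}. D s) \<le> (\<Sum>s\<in>sieve_set c q l k - {0}. card (D s))"
      by (rule card_UN_le[OF finS[OF l]])
    also have "\<dots> \<le> (\<Sum>s\<in>sieve_set c q l k - {0}. k\<^sup>2)" using D[OF l] by (rule sum_mono)
    finally show "card (\<Union>s\<in>sieve_set c q l k - {0}. D s) \<le> card (sieve_set c q l k - {0}) * k\<^sup>2" by simp
  qed
  finally have "real (card (bad_primes c q k)) \<le> (\<Sum>l\<in>K. real (card (sieve_set c q l k - {0})) * (real k)\<^sup>2)"
    by (simp flip: of_nat_mult of_nat_power of_nat_sum)
  also have "\<dots> \<le> (\<Sum>l\<in>K. 2 powr (c * (real k)\<^sup>2 - real k / 5) * (real k)\<^sup>2)"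
    using S by (intro sum_mono mult_right_mono) auto
  also have "\<dots> = real (card K) * (2 powr (c * (real k)\<^sup>2 - real k / 5) * (real k)\<^sup>2)" by simp
  also have "\<dots> \<le> real k * (2 powr (c * (real k)\<^sup>2 - real k / 5) * (real k)\<^sup>2)"
    using card_mono[OF _ K] by (intro mult_right_mono) auto
  finally show ?thesis by (simp add: power3_eq_cube power2_eq_square mult_ac)
qed

section \<open>Lower bound for the count and the exponent\<close>

text \<open>Chebyshev's bound at the upper end of the block, less all integers up to the lower end;
  these are fewer by a factor exponential in \<open>k\<close>.\<close>

lemma card_prime_block_lower:
  assumes "k \<ge> 4"
  shows "(2 powr (c * (real k)\<^sup>2 - 3) - 3) / (c * (real k)\<^sup>2 - 3) - 2 powr (c * (real k - 1)\<^sup>2 - 3)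
    \<le> real (card (prime_block c k))"
proof -
  define X Y where "X = 2 powr (c * (real k)\<^sup>2 - 3)" and "Y = 2 powr (c * (real k - 1)\<^sup>2 - 3)"
  let ?S = "{p::nat. prime p \<and> real p \<le> X}" and ?T = "{p::nat. 1 \<le> p \<and> real p \<le> Y}"
  \<comment> \<open>For \<open>k \<ge> 4\<close> the exponent is at least 2, so that
    \<open>X \<ge> 4\<close> as \<open>prime_count_lower\<close> demands.\<close>
  have "41 / 100 * 4\<^sup>2 \<le> c * (real k)\<^sup>2" using c_bounds assms by (intro mult_mono power_mono) auto
  hence "2 powr 2 \<le> X" unfolding X_def by (intro powr_mono) auto
  hence "(X - 3) / log 2 X \<le> real (card ?S)" by (intro prime_count_lower) simp
  hence "(X - 3) / (c * (real k)\<^sup>2 - 3) \<le> real (card ?S)" by (simp add: X_def)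
  moreover have T: "finite ?T" "real (card ?T) \<le> Y"
    by (rule card_nat_le_real[OF order_refl]; simp add: Y_def)+
  moreover have "card ?S \<le> card (prime_block c k) + card ?T"
  proof -
    have "?S \<subseteq> prime_block c k \<union> ?T"
      by (auto simp: prime_block_def X_def Y_def Suc_le_eq prime_gt_0_nat)
    hence "card ?S \<le> card (prime_block c k \<union> ?T)"
      using T card_prime_block_upper by (intro card_mono) auto
    thus ?thesis using card_Un_le le_trans by blast
  qed
  ultimately show ?thesis unfolding X_def Y_def by linarith
qed

text \<open>A prime of the block is counted unless it is bad or among the finitely many primes
  lacking a digit; \<open>block_growth\<close> is applied with \<open>F\<close> the number of the
  latter.\<close>

lemma card_good_block_lower:
  "\<forall>\<^sub>F k in at_top. spaced k \<longrightarrow> 2 powr (c * (real k)\<^sup>2 - real k) \<le> real (card (good_defined \<inter> prime_block c k))"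
proof -
  define U where "U = {p. prime p \<and> \<not> term_defined c q g p}"
  have finU: "finite U"
    unfolding U_def c_def using q_prime q_bounds g_primroot by (intro finite_not_term_defined) auto
  have "\<forall>\<^sub>F k::nat in at_top. k \<ge> 4" by (rule eventually_ge_at_top)
  moreover have "c > 0" using c_bounds by simp
  note block_growth[OF this, of "card U"]
  ultimately show ?thesis
  proof eventually_elim
    case (elim k)
    show ?case
    proof
      assume sp: "spaced k"
      have "prime_block c k \<subseteq> (good_defined \<inter> prime_block c k) \<union> (bad_primes c q k \<union> U)"
        using elim(1) unfolding good_defined_def good_primes_def U_def by (auto simp: prime_block_def)
      moreover have "bad_primes c q k \<subseteq> prime_block c k" by (auto simp: bad_primes_def)
      hence "finite (bad_primes c q k)" using card_prime_block_upper(1) by (rule finite_subset)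
      ultimately have "card (prime_block c k) \<le> card ((good_defined \<inter> prime_block c k) \<union> (bad_primes c q k \<union> U))"
        using finU card_prime_block_upper(1)[of k] by (intro card_mono) auto
      also have "\<dots> \<le> card (good_defined \<inter> prime_block c k) + (card (bad_primes c q k) + card U)"
        using card_Un_le[of "good_defined \<inter> prime_block c k" "bad_primes c q k \<union> U"]
          card_Un_le[of "bad_primes c q k" U] by linarith
      finally show "2 powr (c * (real k)\<^sup>2 - real k) \<le> real (card (good_defined \<inter> prime_block c k))"
        using elim(2) card_prime_block_lower[OF elim(1)] card_bad_primes_upper[OF sp] by linarith
    qed
  qed
qed

text \<open>A single block is enough. All its terms are at most x if k^2 + 4k \<le> log_2 x, that
  is, if k \<le> r - 2 for r = sqrt(log_2 x + 4).\<close>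

lemma count_lower:
  "\<forall>\<^sub>F x in at_top. 2 powr (c * (sqrt (log 2 x + 4) - 4)\<^sup>2 - sqrt (log 2 x + 4))
    \<le> real (card {p \<in> good_defined. real (a p) \<le> x})"
proof -
  obtain k0 where k0: "\<And>k. k \<ge> k0 \<Longrightarrow> spaced k \<Longrightarrow>
      2 powr (c * (real k)\<^sup>2 - real k) \<le> real (card (good_defined \<inter> prime_block c k))"
    using card_good_block_lower unfolding eventually_at_top_linorder by blast
  have "\<forall>\<^sub>F x::real in at_top. x \<ge> 1" by (rule eventually_ge_at_top)
  moreover have "\<forall>\<^sub>F x in at_top. sqrt (log 2 x + 4) \<ge> real k0 + 6" by real_asymp
  ultimately show ?thesis
  proof eventually_elim
    case (elim x)
    define r where "r = sqrt (log 2 x + 4)"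
    have L: "log 2 x = r\<^sup>2 - 4" unfolding r_def using elim(1) by simp
    \<comment> \<open>With this choice both \<open>m\<close> and \<open>Suc m\<close> lie between r
      - 4 and r - 2, and one of them is spaced.\<close>
    define m where "m = nat \<lfloor>r\<rfloor> - 3"
    have m: "real m + 3 \<le> r" "r < real m + 4" using elim(2) unfolding m_def r_def by linarith+
    obtain k where k: "k = m \<or> k = Suc m" "spaced k" using spaced_or_spaced_Suc by blast
    have kr: "r - 4 \<le> real k" "real k \<le> r - 2" using k(1) m by auto
    have k1: "k \<ge> k0" "k \<ge> 2" using elim(2) kr unfolding r_def by linarith+
    have "real (k\<^sup>2 + 4 * k) = (real k + 2)\<^sup>2 - 4" by (simp add: power2_eq_square algebra_simps)
    also have "\<dots> \<le> r\<^sup>2 - 4" using kr by (simp add: power_mono)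
    finally have "2 powr real (k\<^sup>2 + 4 * k) \<le> 2 powr log 2 x" unfolding L by (intro powr_mono) auto
    hence x: "real (2 ^ (k\<^sup>2 + 4 * k)) \<le> x" unfolding powr_real_nat using elim(1) by simp
    have "2 powr (c * (r - 4)\<^sup>2 - r) \<le> 2 powr (c * (real k)\<^sup>2 - real k)"
    proof (intro powr_mono diff_mono mult_left_mono power_mono)
      show "0 \<le> r - 4" using elim(2) by (simp add: r_def)
    qed (use kr c_bounds in auto)
    also have "\<dots> \<le> real (card (good_defined \<inter> prime_block c k))" using k0 k1 k by blast
    also have "\<dots> \<le> real (card {p \<in> good_defined. real (a p) \<le> x})"
    proof (intro of_nat_mono card_mono count_upper(1) elim(1) subsetI CollectI conjI)
      fix p assume p: "p \<in> good_defined \<inter> prime_block c k"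
      hence "lv p = k" using level_eq[of c k p] c_bounds k1 by simp
      hence "a p \<le> 2 ^ (k\<^sup>2 + 4 * k)" using sidon_term_upper[of p] p by simp
      hence "real (a p) \<le> real (2 ^ (k\<^sup>2 + 4 * k))" by (rule of_nat_mono)
      thus "real (a p) \<le> x" using x by linarith
    qed simp
    finally show ?case by (simp add: r_def)
  qed
qed

lemma infinite_good_defined: "infinite good_defined"
proof
  assume fin: "finite good_defined"
  have "c > 0" using c_bounds by simp
  hence "filterlim (\<lambda>y. 2 powr (c * (sqrt (y + 4) - 4)\<^sup>2 - sqrt (y + 4))) at_top at_top"
    by real_asymp
  hence "filterlim (\<lambda>x. 2 powr (c * (sqrt (log 2 x + 4) - 4)\<^sup>2 - sqrt (log 2 x + 4))) at_top at_top"
    by (rule filterlim_compose) real_asymp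
  hence "\<forall>\<^sub>F x in at_top. real (card good_defined) <
      2 powr (c * (sqrt (log 2 x + 4) - 4)\<^sup>2 - sqrt (log 2 x + 4))"
    by (rule filterlim_at_top_dense[THEN iffD1, rule_format])
  with count_lower have "\<forall>\<^sub>F x::real in at_top. False"
  proof eventually_elim
    case (elim x)
    have "card {p \<in> good_defined. real (a p) \<le> x} \<le> card good_defined"
      using fin by (intro card_mono) auto
    thus ?case using elim by linarith
  qed
  thus False by simp
qed

text \<open>The error \<epsilon> is read off from the count, so only its limit is at stake. It lies
  between 0 and a lower bound that tends to 0, because \<open>h x\<close> is asymptotic to c log_2
  x.\<close>

lemma counting_exponent:
  "\<exists>\<epsilon> :: real \<Rightarrow> real. \<epsilon> \<in> o[at_top](\<lambda>_. 1) \<and>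
    (\<forall>\<^sub>F x in at_top. real (card {p \<in> good_defined. real (a p) \<le> x}) = x powr (c + \<epsilon> x))"
proof (intro exI conjI)
  define N where "N x = real (card {p \<in> good_defined. real (a p) \<le> x})" for x
  define \<epsilon> where "\<epsilon> x = log x (N x) - c" for x
  define h where "h x = c * (sqrt (log 2 x + 4) - 4)\<^sup>2 - sqrt (log 2 x + 4)" for x
  have ev: "\<forall>\<^sub>F x in at_top. h x / log 2 x - c \<le> \<epsilon> x \<and> \<epsilon> x \<le> 0 \<and> N x = x powr (c + \<epsilon> x)"
    using count_lower eventually_gt_at_top[of 1]
  proof eventually_elim
    case (elim x)
    have low: "2 powr h x \<le> N x" using elim(1) by (simp add: h_def N_def)
    have N0: "N x > 0" using low by (smt (verit) powr_gt_zero)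
    have "h x \<le> log 2 (N x)" using low N0 by (simp add: le_log_iff)
    hence "h x / log 2 x \<le> log 2 (N x) / log 2 x" using elim(2) by (intro divide_right_mono) auto
    also have "\<dots> = log x (N x)" using elim(2) N0 by (simp add: log_def)
    finally have "h x / log 2 x - c \<le> \<epsilon> x" by (simp add: \<epsilon>_def)
    moreover have "N x \<le> x powr c" unfolding N_def using elim(2) by (intro count_upper) simp
    hence "\<epsilon> x \<le> 0" using elim(2) N0 by (simp add: \<epsilon>_def log_le_iff)
    moreover have "N x = x powr (c + \<epsilon> x)" using elim(2) N0 by (simp add: \<epsilon>_def)
    ultimately show ?case by blast
  qed
  have "c > 0" using c_bounds by simp
  hence "((\<lambda>y. (c * (sqrt (y + 4) - 4)\<^sup>2 - sqrt (y + 4)) / y - c) \<longlongrightarrow> 0) at_top"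
    by real_asymp
  hence "((\<lambda>x. h x / log 2 x - c) \<longlongrightarrow> 0) at_top"
    unfolding h_def by (rule filterlim_compose) real_asymp
  hence "(\<epsilon> \<longlongrightarrow> 0) at_top"
    by (rule tendsto_sandwich[rotated 2, OF _ tendsto_const]) (use ev in \<open>auto elim: eventually_mono\<close>)
  thus "\<epsilon> \<in> o[at_top](\<lambda>_. 1)" by (intro smalloI_tendsto) auto
  show "\<forall>\<^sub>F x in at_top. real (card {p \<in> good_defined. real (a p) \<le> x}) = x powr (c + \<epsilon> x)"
    using ev unfolding N_def by (auto elim: eventually_mono)
qed

end

text \<open>By injectivity, counting the indices \<open>p\<close> amounts to counting the elements
  of the sequence.\<close>

theorem theorem2:
  fixes c :: real and q g :: "nat \<Rightarrow> nat" and P :: "nat set" and a :: "nat \<Rightarrow> nat"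
  defines "c \<equiv> sqrt 2 - 1"
  defines "P \<equiv> {p \<in> good_primes c q. term_defined c q g p}"
  defines "a \<equiv> sidon_term c q g"
  assumes q_prime: "\<And>j. j \<ge> 1 \<Longrightarrow> prime (q j)"
    and q_bounds: "\<And>j. j \<ge> 1 \<Longrightarrow> 2 ^ (2 * j - 1) < q j \<and> q j \<le> 2 ^ (2 * j + 1)"
    and g_primroot: "\<And>j. j \<ge> 1 \<Longrightarrow> residue_primroot (q j) (g j)"
  shows "inj_on a P \<and> infinite (a ` P) \<and> sidon_set (a ` P) \<and>
    (\<exists>\<epsilon> :: real \<Rightarrow> real. \<epsilon> \<in> o[at_top](\<lambda>_. 1) \<and>
      (\<forall>\<^sub>F x in at_top. real (card {p \<in> P. real (a p) \<le> x}) = x powr (sqrt 2 - 1 + \<epsilon> x)))"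
proof -
  interpret sidon_parameters c q g
    by unfold_locales (use c_def q_prime q_bounds g_primroot in auto)
  have P: "P = good_defined" unfolding P_def good_defined_def by simp
  show ?thesis
    using sidon_term_inj_on infinite_good_defined sidon_set_image counting_exponent
    unfolding P a_def c_def by (simp add: finite_image_iff)
qed

end
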